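(* Let $X$ be a Tychonoff space. The following conditions are equivalent: (1) the space $C_p(X)$ is $\kappa$-Fréchet-Urysohn; (2) the space $B_1(X)$ is Baire.
   Context: All spaces are Tychonoff. $C_p(X)$ is the set of all continuous functions $X\to\mathbb{R}$ with the topology of pointwise convergence. A function $f:X\to\mathbb{R}$ is a Baire-one function if it is the pointwise limit of a sequence of continuous real-valued functions on $X$; $B_1(X)$ is the set of all Baire-one functions on $X$ with the topology of pointwise convergence. A space $Y$ is $\kappa$-Fréchet-Urysohn if for every open set $U\subseteq Y$ and every point $y\in\overline{U}$ there is a sequence $\{y_n:n\in\mathbb{N}\}\subseteq U$ converging to $y$. A topological space is Baire if the intersection of any sequence of its open dense subsets is dense. *)

theory Defs
  imports "HOL-Analysis.Analysis"
begin

text \<open>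
  Real-valued functions on a space \<open>X\<close> are represented as points of \<open>powertop_real (topspace X)\<close>,
  i.e. as total functions taking the value \<open>undefined\<close> outside \<open>topspace X\<close>, so that each function
  on \<open>X\<close> has exactly one representative. Forming the subtopology discards all other representatives.
\<close>

definition Cp :: "'a topology \<Rightarrow> ('a \<Rightarrow> real) topology" where
  "Cp X = subtopology (powertop_real (topspace X)) {f. continuous_map X euclideanreal f}"

definition baire_one :: "'a topology \<Rightarrow> ('a \<Rightarrow> real) \<Rightarrow> bool" where
  "baire_one X f \<longleftrightarrow>
     (\<exists>g :: nat \<Rightarrow> 'a \<Rightarrow> real. (\<forall>n. continuous_map X euclideanreal (g n)) \<and>
        (\<forall>x \<in> topspace X. (\<lambda>n. g n x) \<longlonglongrightarrow> f x))"

definition B1 :: "'a topology \<Rightarrow> ('a \<Rightarrow> real) topology" where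
  "B1 X = subtopology (powertop_real (topspace X)) {f. baire_one X f}"

definition kappa_Frechet_Urysohn :: "'a topology \<Rightarrow> bool" where
  "kappa_Frechet_Urysohn Y \<longleftrightarrow>
     (\<forall>U y. openin Y U \<and> y \<in> Y closure_of U \<longrightarrow>
        (\<exists>s :: nat \<Rightarrow> 'a. range s \<subseteq> U \<and> limitin Y s y sequentially))"

definition Baire_space :: "'a topology \<Rightarrow> bool" where
  "Baire_space Y \<longleftrightarrow>
     (\<forall>D :: nat \<Rightarrow> 'a set. (\<forall>n. openin Y (D n) \<and> Y closure_of (D n) = topspace Y) \<longrightarrow>
        Y closure_of (\<Inter>n. D n) = topspace Y)"

end

theory Submission
  imports Defs
begin

text \<open>
  Both conditions are equivalent to Sakai's property \<open>(\<kappa>)\<close>: every disjoint sequence of finite sets has a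
  subsequence that expands to a point-finite sequence of open sets. From either condition, \<open>(\<kappa>)\<close>
  follows by applying it to functions that are large on some \<open>F n\<close>. Conversely, point-finite expansions
  permit arbitrary continuous changes of a function on the sets \<open>F n\<close> and small changes elsewhere: at each
  point only finitely many changes are large. For the Baire property only a
  subsequence of stages is available, so the finite set that forces membership in the \<open>n\<close>-th dense
  open set must be chosen uniformly for all functions bounded by \<open>n\<close>, up to small perturbation on
  the previous finite set.
\<close>

section \<open>Open sets and convergence in \<open>Cp X\<close> and \<open>B1 X\<close>\<close>

lemma openin_powertop_real_cylinder:
  assumes "finite K" "K \<subseteq> S" "\<And>x. x \<in> K \<Longrightarrow> open (W x)"
  shows "openin (subtopology (powertop_real S) A) {f \<in> extensional S \<inter> A. \<forall>x\<in>K. f x \<in> W x}"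
proof -
  let ?B = "\<lambda>x. if x \<in> K then W x else UNIV"
  have "finite {x \<in> S. ?B x \<noteq> UNIV}"
    by (rule finite_subset[OF _ assms(1)]) auto
  then have "openin (powertop_real S) (PiE S ?B)"
    using assms(3) by (auto simp: openin_PiE_gen)
  then have "openin (subtopology (powertop_real S) A) (PiE S ?B \<inter> A)"
    by (auto simp: openin_subtopology)
  also have "PiE S ?B \<inter> A = {f \<in> extensional S \<inter> A. \<forall>x\<in>K. f x \<in> W x}"
    using assms(2) by (auto simp: PiE_iff extensional_def split: if_splits)
  finally show ?thesis .
qed

text \<open>A basic box of the product topology restricts only finitely many coordinates, so the
  radii available there have a positive minimum. The pair \<open>K\<close>, \<open>\<delta>\<close>
  is the form in which openness is exploited in both function spaces.\<close>

lemma openin_subtopology_powertop_real: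
  "openin (subtopology (powertop_real S) A) U \<longleftrightarrow>
     U \<subseteq> extensional S \<inter> A \<and>
     (\<forall>f\<in>U. \<exists>K \<delta>. finite K \<and> K \<subseteq> S \<and> \<delta> > 0 \<and>
        (\<forall>g\<in>extensional S \<inter> A. (\<forall>x\<in>K. \<bar>g x - f x\<bar> < \<delta>) \<longrightarrow> g \<in> U))"
    (is "?lhs \<longleftrightarrow> ?rhs")
proof
  assume ?lhs
  then obtain T where T: "openin (powertop_real S) T" "U = T \<inter> A"
    by (auto simp: openin_subtopology)
  have "T \<subseteq> extensional S"
    using openin_subset[OF T(1)] by (auto simp: PiE_def)
  moreover have "\<exists>K \<delta>. finite K \<and> K \<subseteq> S \<and> \<delta> > 0 \<and>
      (\<forall>g\<in>extensional S \<inter> A. (\<forall>x\<in>K. \<bar>g x - f x\<bar> < \<delta>) \<longrightarrow> g \<in> U)" if "f \<in> U" for f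
  proof -
    obtain V where V: "finite {i \<in> S. V i \<noteq> UNIV}" "\<forall>i\<in>S. open (V i)" "f \<in> PiE S V" "PiE S V \<subseteq> T"
      using T \<open>f \<in> U\<close> unfolding openin_product_topology_alt by fastforce
    define K where "K = {i \<in> S. V i \<noteq> UNIV}"
    have "\<exists>e>0. \<forall>y. \<bar>y - f i\<bar> < e \<longrightarrow> y \<in> V i" if "i \<in> K" for i
      using V(2,3) that unfolding K_def open_dist dist_real_def PiE_iff by blast
    then obtain e where e: "\<And>i. i \<in> K \<Longrightarrow> e i > 0 \<and> (\<forall>y. \<bar>y - f i\<bar> < e i \<longrightarrow> y \<in> V i)"
      by metis
    \<comment> \<open>The extra \<open>1\<close> keeps \<open>Min\<close> meaningful when
      \<open>K\<close> is empty.\<close>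
    define \<delta> where "\<delta> = Min (insert 1 (e ` K))"
    have "finite K"
      using V(1) by (simp add: K_def)
    then have \<delta>: "\<delta> > 0" "\<And>i. i \<in> K \<Longrightarrow> \<delta> \<le> e i"
      using e by (auto simp: \<delta>_def)
    have "g \<in> U" if "g \<in> extensional S \<inter> A" "\<forall>x\<in>K. \<bar>g x - f x\<bar> < \<delta>" for g
    proof -
      have "g x \<in> V x" if "x \<in> S" for x
      proof (cases "x \<in> K")
        case True
        then show ?thesis
          using e \<delta>(2) \<open>\<forall>x\<in>K. \<bar>g x - f x\<bar> < \<delta>\<close> by (meson less_le_trans)
      next
        case False
        then show ?thesis
          using that by (simp add: K_def)
      qed
      then show ?thesis
        using that V(4) T(2) by (auto simp: PiE_def Pi_def)
    qed
    moreover have "K \<subseteq> S"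
      by (auto simp: K_def)
    ultimately show ?thesis
      using \<open>finite K\<close> \<delta>(1) by blast
  qed
  ultimately show ?rhs
    using T(2) by blast
next
  assume R: ?rhs
  show ?lhs
  proof (subst openin_subopen, intro ballI)
    fix f assume "f \<in> U"
    then obtain K \<delta> where K: "finite K" "K \<subseteq> S" "\<delta> > 0"
      "\<And>g. g \<in> extensional S \<inter> A \<Longrightarrow> (\<forall>x\<in>K. \<bar>g x - f x\<bar> < \<delta>) \<Longrightarrow> g \<in> U"
      using R by meson
    let ?T = "{g \<in> extensional S \<inter> A. \<forall>x\<in>K. g x \<in> ball (f x) \<delta>}"
    have "openin (subtopology (powertop_real S) A) ?T"
      using K(1,2) by (intro openin_powertop_real_cylinder) auto
    moreover have "f \<in> ?T"
      using \<open>f \<in> U\<close> R K(3) by auto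
    moreover have "?T \<subseteq> U"
      using K(4) by (auto simp: dist_real_def abs_minus_commute)
    ultimately show "\<exists>T. openin (subtopology (powertop_real S) A) T \<and> f \<in> T \<and> T \<subseteq> U"
      by blast
  qed
qed

lemma topspace_Cp: "topspace (Cp X) = extensional (topspace X) \<inter> {f. continuous_map X euclideanreal f}"
  by (auto simp: Cp_def PiE_def)

lemma topspace_B1: "topspace (B1 X) = extensional (topspace X) \<inter> {f. baire_one X f}"
  by (auto simp: B1_def PiE_def)

lemma openin_Cp:
  "openin (Cp X) U \<longleftrightarrow> U \<subseteq> topspace (Cp X) \<and>
     (\<forall>f\<in>U. \<exists>K \<delta>. finite K \<and> K \<subseteq> topspace X \<and> \<delta> > 0 \<and>
        (\<forall>g\<in>topspace (Cp X). (\<forall>x\<in>K. \<bar>g x - f x\<bar> < \<delta>) \<longrightarrow> g \<in> U))"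
  unfolding topspace_Cp unfolding Cp_def by (rule openin_subtopology_powertop_real)

lemma openin_B1:
  "openin (B1 X) U \<longleftrightarrow> U \<subseteq> topspace (B1 X) \<and>
     (\<forall>f\<in>U. \<exists>K \<delta>. finite K \<and> K \<subseteq> topspace X \<and> \<delta> > 0 \<and>
        (\<forall>g\<in>topspace (B1 X). (\<forall>x\<in>K. \<bar>g x - f x\<bar> < \<delta>) \<longrightarrow> g \<in> U))"
  unfolding topspace_B1 unfolding B1_def by (rule openin_subtopology_powertop_real)

lemma openin_Cp_cylinder:
  assumes "finite K" "K \<subseteq> topspace X" "\<And>x. x \<in> K \<Longrightarrow> open (W x)"
  shows "openin (Cp X) {f \<in> topspace (Cp X). \<forall>x\<in>K. f x \<in> W x}"
  unfolding topspace_Cp unfolding Cp_def using assms by (rule openin_powertop_real_cylinder)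

lemma openin_B1_cylinder:
  assumes "finite K" "K \<subseteq> topspace X" "\<And>x. x \<in> K \<Longrightarrow> open (W x)"
  shows "openin (B1 X) {f \<in> topspace (B1 X). \<forall>x\<in>K. f x \<in> W x}"
  unfolding topspace_B1 unfolding B1_def using assms by (rule openin_powertop_real_cylinder)

lemma limitin_Cp:
  assumes "range s \<subseteq> topspace (Cp X)" "y \<in> topspace (Cp X)"
  shows "limitin (Cp X) s y sequentially \<longleftrightarrow> (\<forall>x\<in>topspace X. (\<lambda>n. s n x) \<longlonglongrightarrow> y x)"
proof -
  have "s n \<in> extensional (topspace X) \<and> continuous_map X euclideanreal (s n)" for n
    using assms by (auto simp: topspace_Cp)
  then show ?thesis
    using assms(2) by (auto simp: topspace_Cp Cp_def limitin_subtopology limitin_componentwise PiE_iff)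
qed

lemma continuous_map_restrict_topspace:
  "continuous_map X Y (restrict f (topspace X)) \<longleftrightarrow> continuous_map X Y f"
  by (auto intro: continuous_map_eq)

lemma restrict_in_Cp:
  "continuous_map X euclideanreal f \<Longrightarrow> restrict f (topspace X) \<in> topspace (Cp X)"
  by (simp add: topspace_Cp continuous_map_restrict_topspace)

lemma restrict_in_B1:
  "baire_one X f \<Longrightarrow> restrict f (topspace X) \<in> topspace (B1 X)"
  by (auto simp: topspace_B1 baire_one_def)

lemma continuous_imp_baire_one: "continuous_map X euclideanreal f \<Longrightarrow> baire_one X f"
  unfolding baire_one_def by (rule exI[of _ "\<lambda>_. f"]) auto

section \<open>Continuous functions with prescribed values on finite sets\<close>

lemma bump_on_finite_set:
  assumes "completely_regular_space X" "finite F" "F \<subseteq> V" "openin X V"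
  obtains \<phi> where "continuous_map X euclideanreal \<phi>" "\<And>x. x \<in> topspace X \<Longrightarrow> \<phi> x \<in> {0..1}"
    "\<And>x. x \<in> F \<Longrightarrow> \<phi> x = 1" "\<And>x. x \<in> topspace X - V \<Longrightarrow> \<phi> x = (0::real)"
proof -
  have "\<exists>f. continuous_map X (top_of_set {0..1::real}) f \<and> f a = 0 \<and> f ` (topspace X - V) \<subseteq> {1}"
    if "a \<in> F" for a
  proof -
    have "closedin X (topspace X - V)" "a \<in> topspace X - (topspace X - V)"
      using assms that openin_subset[OF assms(4)] by auto
    then show ?thesis
      using assms(1) unfolding completely_regular_space_def by blast
  qed
  then obtain f where f: "\<And>a. a \<in> F \<Longrightarrow> continuous_map X (top_of_set {0..1::real}) (f a)"
    "\<And>a. a \<in> F \<Longrightarrow> f a a = 0" "\<And>a. a \<in> F \<Longrightarrow> f a ` (topspace X - V) \<subseteq> {1}"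
    by metis
  have f01: "f a x \<in> {0..1}" if "a \<in> F" "x \<in> topspace X" for a x
    using f(1)[OF that(1)] that(2) by (auto simp: continuous_map_in_subtopology)
  \<comment> \<open>Each \<open>f a\<close> is 0 at \<open>a\<close> and 1 off \<open>V\<close>, so
    their product vanishes on all of \<open>F\<close> and is 1 off \<open>V\<close>.\<close>
  define \<phi> where "\<phi> x = 1 - (\<Prod>a\<in>F. f a x)" for x
  show thesis
  proof
    show "continuous_map X euclideanreal \<phi>"
      unfolding \<phi>_def using f(1) assms(2)
      by (intro continuous_intros) (auto simp: continuous_map_in_subtopology)
    show "\<phi> x \<in> {0..1}" if "x \<in> topspace X" for x
      using f01[OF _ that] by (auto simp: \<phi>_def intro!: prod_nonneg prod_le_1)
    show "\<phi> x = 1" if "x \<in> F" for x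
      using f(2) that assms(2) by (auto simp: \<phi>_def)
    show "\<phi> x = 0" if "x \<in> topspace X - V" for x
      using f(3) that by (auto simp: \<phi>_def image_subset_iff intro!: prod.neutral)
  qed
qed

text \<open>As in Lagrange interpolation, \<open>p\<close> is spread over functions
  \<open>e a\<close> that are 1 at \<open>a\<close> and 0 on the rest of \<open>K\<close>; these
  exist because finite sets are closed. The bound \<open>B\<close> later keeps the approximations
  bounded.\<close>

lemma finite_interpolation:
  fixes p :: "'a \<Rightarrow> real"
  assumes "completely_regular_space X" "Hausdorff_space X" "finite K" "K \<subseteq> topspace X"
  obtains h B where "continuous_map X euclideanreal h" "\<And>x. x \<in> K \<Longrightarrow> h x = p x"
    "\<And>x. x \<in> topspace X \<Longrightarrow> \<bar>h x\<bar> \<le> B"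
proof -
  have "\<exists>e. continuous_map X euclideanreal e \<and> (\<forall>x\<in>topspace X. e x \<in> {0..1}) \<and> e a = 1 \<and>
      (\<forall>x\<in>K - {a}. e x = (0::real))" if "a \<in> K" for a
  proof -
    have "closedin X (K - {a})"
      using assms by (meson Diff_subset closedin_Hausdorff_finite finite_Diff subset_trans)
    then have "openin X (topspace X - (K - {a}))"
      by blast
    moreover have "{a} \<subseteq> topspace X - (K - {a})"
      using that assms(4) by auto
    ultimately obtain e where "continuous_map X euclideanreal e" "\<And>x. x \<in> topspace X \<Longrightarrow> e x \<in> {0..1}"
      "\<And>x. x \<in> {a} \<Longrightarrow> e x = 1" "\<And>x. x \<in> topspace X - (topspace X - (K - {a})) \<Longrightarrow> e x = (0::real)"
      using bump_on_finite_set[OF assms(1), of "{a}"] by blast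
    then show ?thesis
      using assms(4) by (intro exI[of _ e]) auto
  qed
  then obtain e where e: "\<And>a. a \<in> K \<Longrightarrow> continuous_map X euclideanreal (e a)"
    "\<And>a x. a \<in> K \<Longrightarrow> x \<in> topspace X \<Longrightarrow> e a x \<in> {0..1}" "\<And>a. a \<in> K \<Longrightarrow> e a a = 1"
    "\<And>a x. a \<in> K \<Longrightarrow> x \<in> K - {a} \<Longrightarrow> e a x = (0::real)"
    by metis
  show thesis
  proof
    show "continuous_map X euclideanreal (\<lambda>x. \<Sum>a\<in>K. p a * e a x)"
      using assms(3) e(1) by (intro continuous_intros) auto
    show "(\<Sum>a\<in>K. p a * e a x) = p x" if "x \<in> K" for x
    proof -
      have "(\<Sum>a\<in>K. p a * e a x) = (\<Sum>a\<in>K. if a = x then p a else 0)"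
        using e(3,4) that by (intro sum.cong) auto
      then show ?thesis
        using that assms(3) by simp
    qed
    show "\<bar>\<Sum>a\<in>K. p a * e a x\<bar> \<le> (\<Sum>a\<in>K. \<bar>p a\<bar>)" if "x \<in> topspace X" for x
    proof (rule order_trans[OF sum_abs sum_mono])
      fix a assume "a \<in> K"
      then show "\<bar>p a * e a x\<bar> \<le> \<bar>p a\<bar>"
        using e(2)[OF \<open>a \<in> K\<close> that] by (simp add: abs_mult mult_left_le)
    qed
  qed
qed

text \<open>A bump function blends \<open>h\<close> with its truncation to the interval from
  \<open>-\<epsilon>\<close> to \<open>\<epsilon>\<close>: \<open>h\<close> survives on
  \<open>F\<close>, only the truncation is left off \<open>V\<close>, and where \<open>h\<close> is
  already small both agree. Large changes are thereby confined to \<open>V\<close>.\<close>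

lemma truncate_outside:
  fixes h :: "'a \<Rightarrow> real"
  assumes "completely_regular_space X" "finite F" "F \<subseteq> V" "openin X V"
    and "continuous_map X euclideanreal h" "\<epsilon> \<ge> 0"
  obtains g where "continuous_map X euclideanreal g" "\<And>x. x \<in> F \<Longrightarrow> g x = h x"
    "\<And>x. \<bar>h x\<bar> \<le> \<epsilon> \<Longrightarrow> g x = h x" "\<And>x. x \<in> topspace X - V \<Longrightarrow> \<bar>g x\<bar> \<le> \<epsilon>"
    "\<And>x. x \<in> topspace X \<Longrightarrow> \<bar>g x\<bar> \<le> \<bar>h x\<bar>"
proof -
  obtain \<phi> where \<phi>: "continuous_map X euclideanreal \<phi>" "\<And>x. x \<in> topspace X \<Longrightarrow> \<phi> x \<in> {0..1}"
    "\<And>x. x \<in> F \<Longrightarrow> \<phi> x = 1" "\<And>x. x \<in> topspace X - V \<Longrightarrow> \<phi> x = (0::real)"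
    using bump_on_finite_set[OF assms(1-4)] by blast
  define c where "c x = max (-\<epsilon>) (min \<epsilon> (h x))" for x
  define g where "g x = \<phi> x * h x + (1 - \<phi> x) * c x" for x
  show thesis
  proof
    show "continuous_map X euclideanreal g"
      unfolding g_def c_def using \<phi>(1) assms(5) by (intro continuous_intros) auto
    show "g x = h x" if "x \<in> F" for x
      using \<phi>(3)[OF that] by (simp add: g_def)
    show "g x = h x" if "\<bar>h x\<bar> \<le> \<epsilon>" for x
    proof -
      have "c x = h x"
        using that by (auto simp: c_def)
      then show ?thesis
        by (simp add: g_def algebra_simps)
    qed
    show "\<bar>g x\<bar> \<le> \<epsilon>" if "x \<in> topspace X - V" for x
      using \<phi>(4)[OF that] assms(6) by (simp add: g_def c_def)
    show "\<bar>g x\<bar> \<le> \<bar>h x\<bar>" if "x \<in> topspace X" for x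
    proof -
      have "\<bar>c x\<bar> \<le> \<bar>h x\<bar>"
        using assms(6) by (auto simp: c_def)
      have "\<bar>g x\<bar> \<le> \<phi> x * \<bar>h x\<bar> + (1 - \<phi> x) * \<bar>c x\<bar>"
        unfolding g_def using \<phi>(2)[OF that] by (intro order_trans[OF abs_triangle_ineq]) (simp add: abs_mult)
      also have "\<dots> \<le> \<phi> x * \<bar>h x\<bar> + (1 - \<phi> x) * \<bar>h x\<bar>"
        using \<phi>(2)[OF that] \<open>\<bar>c x\<bar> \<le> \<bar>h x\<bar>\<close> by (intro add_left_mono mult_left_mono) auto
      finally show ?thesis
        by (simp add: algebra_simps)
    qed
  qed
qed

section \<open>Property (kappa) and disjoint sequences of finite sets\<close>

definition kappa_property :: "'a topology \<Rightarrow> bool" where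
  "kappa_property X \<longleftrightarrow>
     (\<forall>F :: nat \<Rightarrow> 'a set. disjoint_family F \<and> (\<forall>n. finite (F n) \<and> F n \<noteq> {} \<and> F n \<subseteq> topspace X) \<longrightarrow>
        (\<exists>r V. strict_mono r \<and> (\<forall>k. openin X (V k) \<and> F (r k) \<subseteq> V k) \<and>
           (\<forall>x\<in>topspace X. finite {k :: nat. x \<in> V k})))"

text \<open>Allows an expansion to be built over an infinite index set. Its increasing enumeration
  is the subsequence, and injectivity of the enumeration preserves point-finiteness.\<close>

lemma subsequence_of_infinite:
  fixes F V :: "nat \<Rightarrow> 'a set"
  assumes "infinite I" "\<And>n. n \<in> I \<Longrightarrow> openin X (V n) \<and> F n \<subseteq> V n"
    "\<And>x. x \<in> topspace X \<Longrightarrow> finite {n \<in> I. x \<in> V n}"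
  shows "\<exists>r V. strict_mono r \<and> (\<forall>k. openin X (V k) \<and> F (r k) \<subseteq> V k) \<and>
           (\<forall>x\<in>topspace X. finite {k :: nat. x \<in> V k})"
proof (intro exI conjI allI ballI)
  let ?r = "enumerate I"
  show r: "strict_mono ?r"
    using assms(1) by (simp add: strict_mono_def)
  have I: "?r k \<in> I" for k
    using assms(1) by (rule enumerate_in_set)
  show "openin X (V (?r k))" "F (?r k) \<subseteq> V (?r k)" for k
    using assms(2)[OF I] by auto
  show "finite {k. x \<in> V (?r k)}" if "x \<in> topspace X" for x
  proof -
    have "finite (?r -` {n \<in> I. x \<in> V n})"
      using assms(3)[OF that] r by (intro finite_vimageI) (auto simp: strict_mono_imp_increasing strict_mono_eq inj_def)
    then show ?thesis
      using I by (simp add: vimage_def)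
  qed
qed

text \<open>In the applications the sets are differences \<open>K (Suc n) - K n\<close>, which may
  be empty. If infinitely many are empty, these are selected with empty neighbourhoods; otherwise a
  shift by \<open>N\<close> leaves only nonempty ones.\<close>

lemma kappa_propertyD:
  fixes F :: "nat \<Rightarrow> 'a set"
  assumes "kappa_property X" "disjoint_family F" "\<And>n. finite (F n)" "\<And>n. F n \<subseteq> topspace X"
  obtains r V where "strict_mono r" "\<And>k. openin X (V k)" "\<And>k. F (r k) \<subseteq> V k"
    "\<And>x. x \<in> topspace X \<Longrightarrow> finite {k :: nat. x \<in> V k}"
proof -
  have "\<exists>r V. strict_mono r \<and> (\<forall>k. openin X (V k) \<and> F (r k) \<subseteq> V k) \<and>
           (\<forall>x\<in>topspace X. finite {k :: nat. x \<in> V k})"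
  proof (cases "infinite {n. F n = {}}")
    case True
    then show ?thesis
      by (rule subsequence_of_infinite[where V = "\<lambda>_. {}"]) auto
  next
    case False
    then obtain N where N: "\<And>n. F n = {} \<Longrightarrow> n < N"
      by (auto simp: finite_nat_set_iff_bounded)
    have "disjoint_family (\<lambda>n. F (n + N))"
      using assms(2) by (auto simp: disjoint_family_on_def)
    moreover have "F (n + N) \<noteq> {}" for n
      using N[of "n + N"] by auto
    ultimately obtain r V where "strict_mono r" "\<forall>k. openin X (V k) \<and> F (r k + N) \<subseteq> V k"
      "\<forall>x\<in>topspace X. finite {k :: nat. x \<in> V k}"
      using assms(1)[unfolded kappa_property_def, rule_format, of "\<lambda>n. F (n + N)"] assms(3,4) by auto
    then show ?thesis
      by (intro exI[of _ "\<lambda>k. r k + N"] exI[of _ V]) (auto simp: strict_mono_def)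
  qed
  then show thesis
    using that by blast
qed

text \<open>By disjointness each point of \<open>K\<close> lies in at most one \<open>F n\<close>,
  so \<open>K\<close> meets only finitely many of them.\<close>

lemma disjoint_family_avoid_finite:
  fixes F :: "nat \<Rightarrow> 'a set"
  assumes "disjoint_family F" "finite K"
  obtains n where "n \<ge> m" "F n \<inter> K = {}"
proof -
  have "\<forall>n\<in>{n. F n \<inter> K \<noteq> {}}. \<exists>x. x \<in> F n \<inter> K"
    by auto
  then obtain x where x: "\<And>n. F n \<inter> K \<noteq> {} \<Longrightarrow> x n \<in> F n \<inter> K"
    by (metis (mono_tags, lifting) mem_Collect_eq)
  have "inj_on x {n. F n \<inter> K \<noteq> {}}"
    using x assms(1) unfolding inj_on_def disjoint_family_on_def by (metis (mono_tags, lifting) Int_iff UNIV_I empty_iff mem_Collect_eq)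
  moreover have "x ` {n. F n \<inter> K \<noteq> {}} \<subseteq> K"
    using x by auto
  ultimately have "finite {n. F n \<inter> K \<noteq> {}}"
    using assms(2) inj_on_finite by blast
  then obtain N where "\<And>n. F n \<inter> K \<noteq> {} \<Longrightarrow> n < N"
    by (auto simp: finite_nat_set_iff_bounded)
  then show thesis
    using that[of "max m N"] by (metis max.cobounded1 max.cobounded2 not_le)
qed

lemma continuous_map_less_open:
  assumes "continuous_map X euclideanreal f"
  shows "openin X {x \<in> topspace X. f x > c}"
  using openin_continuous_map_preimage[OF assms, of "{c<..}"] by simp

text \<open>The source of all density claims below: a basic neighbourhood controls a function only
  on a finite \<open>K\<close>, so on some late \<open>F n\<close> missing \<open>K\<close> it can
  still be made large.\<close>

lemma interpolate_far:
  assumes "completely_regular_space X" "Hausdorff_space X"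
    and "disjoint_family F" "\<And>n :: nat. finite (F n)" "\<And>n. F n \<subseteq> topspace X"
    and "finite K" "K \<subseteq> topspace X"
  obtains n h where "n \<ge> m" "continuous_map X euclideanreal h"
    "\<And>x. x \<in> K \<Longrightarrow> h x = p x" "\<And>x. x \<in> F n \<Longrightarrow> h x = (q n :: real)"
proof -
  obtain n where n: "n \<ge> m" "F n \<inter> K = {}"
    using disjoint_family_avoid_finite[OF assms(3,6)] by blast
  obtain h where h: "continuous_map X euclideanreal h"
    "\<And>x. x \<in> K \<union> F n \<Longrightarrow> h x = (if x \<in> K then p x else q n)"
    using finite_interpolation[OF assms(1,2), of "K \<union> F n" "\<lambda>x. if x \<in> K then p x else q n"] assms
    by (metis finite_Un le_sup_iff)
  show thesis
  proof (rule that[OF n(1) h(1)])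
    show "h x = p x" if "x \<in> K" for x
      using h(2) that by simp
    show "h x = q n" if "x \<in> F n" for x
      using h(2)[of x] that n(2) by (auto split: if_splits)
  qed
qed

section \<open>Property (kappa) from each of the two conditions\<close>

text \<open>The zero function is in the closure of the open set of functions exceeding 1 on some
  \<open>F n\<close>. A sequence from this set converging to zero provides the neighbourhoods
  \<open>s k > 1\<close>, and convergence makes them point-finite.\<close>

lemma kappa_Frechet_Urysohn_imp_kappa_property:
  assumes "completely_regular_space X" "Hausdorff_space X" "kappa_Frechet_Urysohn (Cp X)"
  shows "kappa_property X"
  unfolding kappa_property_def
proof (intro allI impI, elim conjE)
  fix F :: "nat \<Rightarrow> 'a set"
  assume F: "disjoint_family F" and F': "\<forall>n. finite (F n) \<and> F n \<noteq> {} \<and> F n \<subseteq> topspace X"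
  define U where "U = {f \<in> topspace (Cp X). \<exists>n. \<forall>x\<in>F n. f x > 1}"
  have U_eq: "U = (\<Union>n. {f \<in> topspace (Cp X). \<forall>x\<in>F n. f x \<in> {1<..}})"
    by (auto simp: U_def)
  define z where "z = restrict (\<lambda>_. 0 :: real) (topspace X)"
  have z: "z \<in> topspace (Cp X)"
    unfolding z_def by (rule restrict_in_Cp) simp
  have "openin (Cp X) U"
    using openin_Cp_cylinder[of "F _" X "\<lambda>_. {1<..}"] F' by (auto simp: U_eq intro!: openin_Union)
  moreover have "z \<in> Cp X closure_of U"
    unfolding in_closure_of
  proof (intro conjI allI impI z, elim conjE)
    fix T assume "z \<in> T" "openin (Cp X) T"
    then obtain K \<delta> where K: "finite K" "K \<subseteq> topspace X" "\<delta> > 0"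
      "\<And>g. g \<in> topspace (Cp X) \<Longrightarrow> (\<forall>x\<in>K. \<bar>g x - z x\<bar> < \<delta>) \<Longrightarrow> g \<in> T"
      unfolding openin_Cp by meson
    obtain n h where h: "continuous_map X euclideanreal h"
      "\<And>x. x \<in> K \<Longrightarrow> h x = 0" "\<And>x. x \<in> F n \<Longrightarrow> h x = 2"
      using interpolate_far[OF assms(1,2) F _ _ K(1,2), where p = "\<lambda>_. 0" and q = "\<lambda>_. 2"] F' by metis
    let ?g = "restrict h (topspace X)"
    have "?g \<in> topspace (Cp X)"
      using h(1) by (rule restrict_in_Cp)
    moreover have "?g \<in> T"
      using K h(2) by (intro K(4) restrict_in_Cp h(1)) (auto simp: z_def)
    moreover have "\<forall>x\<in>F n. ?g x > 1"
      using h(3) F' by (simp add: subset_iff)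
    ultimately show "\<exists>y. y \<in> U \<and> y \<in> T"
      unfolding U_def by blast
  qed
  ultimately obtain s where s: "range s \<subseteq> U" "limitin (Cp X) s z sequentially"
    using assms(3) unfolding kappa_Frechet_Urysohn_def by meson
  then have "\<forall>x\<in>topspace X. (\<lambda>k. s k x) \<longlonglongrightarrow> z x"
    using limitin_Cp[of s X z] z by (auto simp: U_def)
  then have lim: "(\<lambda>k. s k x) \<longlonglongrightarrow> 0" if "x \<in> topspace X" for x
    using that by (simp add: z_def)
  have fin: "finite {k. s k x > 1}" if "x \<in> topspace X" for x
  proof -
    have "eventually (\<lambda>k. s k x < 1) sequentially"
      using order_tendstoD(2)[OF lim[OF that]] by simp
    then obtain M where M: "\<And>k. k \<ge> M \<Longrightarrow> s k x < 1"
      by (auto simp: eventually_sequentially)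
    have "{k. s k x > 1} \<subseteq> {..<M}"
      using M by (force simp: not_le[symmetric])
    then show ?thesis
      using finite_subset by blast
  qed
  have "\<forall>k. \<exists>n. \<forall>x\<in>F n. s k x > 1"
    using s(1) by (auto simp: U_def)
  then obtain N where N: "\<And>k x. x \<in> F (N k) \<Longrightarrow> s k x > 1"
    by metis
  \<comment> \<open>Otherwise a single \<open>F (N k0)\<close> would serve infinitely many
    \<open>k\<close>, and at any of its points \<open>s k\<close> would exceed 1 infinitely
    often.\<close>
  have "infinite (range N)"
  proof
    assume "finite (range N)"
    then obtain k0 where "infinite {k. N k = N k0}"
      using pigeonhole_infinite[of UNIV N] by auto
    moreover obtain x where x: "x \<in> F (N k0)"
      using F' by blast
    have "{k. N k = N k0} \<subseteq> {k. s k x > 1}"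
      using N x by auto
    moreover have "x \<in> topspace X"
      using x F' by blast
    ultimately show False
      using fin finite_subset by blast
  qed
  \<comment> \<open>One function is kept for each index that occurs. As a right inverse of
    \<open>N\<close>, \<open>j\<close> is injective on \<open>range N\<close>, so point-finiteness
    in \<open>k\<close> carries over to \<open>n\<close>.\<close>
  define j where "j n = (SOME k. N k = n)" for n
  have j: "N (j n) = n" if "n \<in> range N" for n
    using that unfolding j_def by (metis (mono_tags, lifting) imageE someI)
  show "\<exists>r V. strict_mono r \<and> (\<forall>k. openin X (V k) \<and> F (r k) \<subseteq> V k) \<and>
      (\<forall>x\<in>topspace X. finite {k :: nat. x \<in> V k})"
  proof (rule subsequence_of_infinite[OF \<open>infinite (range N)\<close>, where V = "\<lambda>n. {x \<in> topspace X. s (j n) x > 1}"])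
    show "openin X {x \<in> topspace X. s (j n) x > 1} \<and> F n \<subseteq> {x \<in> topspace X. s (j n) x > 1}"
      if "n \<in> range N" for n
    proof
      have "continuous_map X euclideanreal (s (j n))"
        using s(1) by (auto simp: U_def topspace_Cp)
      then show "openin X {x \<in> topspace X. s (j n) x > 1}"
        by (rule continuous_map_less_open)
      show "F n \<subseteq> {x \<in> topspace X. s (j n) x > 1}"
        using N[of _ "j n"] j[OF that] F' by auto
    qed
    show "finite {n \<in> range N. x \<in> {x \<in> topspace X. s (j n) x > 1}}" if "x \<in> topspace X" for x
    proof (rule inj_on_finite[OF _ _ fin[OF that]])
      show "inj_on j {n \<in> range N. x \<in> {x \<in> topspace X. s (j n) x > 1}}"
        by (rule inj_onI) (metis (mono_tags, lifting) j mem_Collect_eq)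
    qed auto
  qed
qed

text \<open>A generic Baire-one function exceeds \<open>n\<close> on \<open>F n\<close> for
  infinitely many \<open>n\<close>. Continuous functions converging to it already do so on the
  finite set \<open>F n\<close>, and their boundedness at each point gives point-finiteness.\<close>

lemma Baire_B1_imp_kappa_property:
  assumes "completely_regular_space X" "Hausdorff_space X" "Baire_space (B1 X)"
  shows "kappa_property X"
  unfolding kappa_property_def
proof (intro allI impI, elim conjE)
  fix F :: "nat \<Rightarrow> 'a set"
  assume F: "disjoint_family F" and F': "\<forall>n. finite (F n) \<and> F n \<noteq> {} \<and> F n \<subseteq> topspace X"
  \<comment> \<open>Requiring an index beyond \<open>m\<close> makes membership in every
    \<open>D m\<close> yield infinitely many indices. The growing threshold \<open>n\<close> is what
    a bound at a point will contradict.\<close>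
  define D where "D m = {f \<in> topspace (B1 X). \<exists>n\<in>{m..}. \<forall>x\<in>F n. f x > real n}" for m
  have "D m = (\<Union>n\<in>{m..}. {f \<in> topspace (B1 X). \<forall>x\<in>F n. f x \<in> {real n<..}})" for m
    by (auto simp: D_def)
  then have "openin (B1 X) (D m)" for m
    using openin_B1_cylinder[of "F _" X "\<lambda>_. {real _<..}"] F' by (auto intro!: openin_Union)
  moreover have "B1 X closure_of (D m) = topspace (B1 X)" for m
  proof -
    have "f \<in> B1 X closure_of (D m)" if f: "f \<in> topspace (B1 X)" for f
      unfolding in_closure_of
    proof (intro conjI allI impI f, elim conjE)
      fix T assume "f \<in> T" "openin (B1 X) T"
      then obtain K \<delta> where K: "finite K" "K \<subseteq> topspace X" "\<delta> > 0"
        "\<And>g. g \<in> topspace (B1 X) \<Longrightarrow> (\<forall>x\<in>K. \<bar>g x - f x\<bar> < \<delta>) \<Longrightarrow> g \<in> T"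
        unfolding openin_B1 by meson
      obtain n h where h: "n \<ge> m" "continuous_map X euclideanreal h"
        "\<And>x. x \<in> K \<Longrightarrow> h x = f x" "\<And>x. x \<in> F n \<Longrightarrow> h x = real n + 1"
        using interpolate_far[OF assms(1,2) F _ _ K(1,2), where p = f and q = "\<lambda>n. real n + 1" and m = m] F' by metis
      let ?g = "restrict h (topspace X)"
      have "?g \<in> topspace (B1 X)"
        using h(2) by (intro restrict_in_B1 continuous_imp_baire_one)
      moreover have "?g \<in> T"
        using K h(3) calculation by (intro K(4)) auto
      moreover have "\<forall>x\<in>F n. ?g x > real n"
        using h(4) F' by (simp add: subset_iff)
      ultimately show "\<exists>y. y \<in> D m \<and> y \<in> T"
        unfolding D_def using h(1) by blast
    qed
    then show ?thesis
      using closure_of_subset_topspace[of "B1 X" "D m"] by blast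
  qed
  ultimately have "B1 X closure_of (\<Inter>m. D m) = topspace (B1 X)"
    using assms(3) unfolding Baire_space_def by blast
  moreover have "restrict (\<lambda>_. 0) (topspace X) \<in> topspace (B1 X)"
    by (intro restrict_in_B1 continuous_imp_baire_one) simp
  ultimately have "(\<Inter>m. D m) \<noteq> {}"
    by force
  then obtain f where f: "\<And>m. f \<in> D m"
    by blast
  then have "f \<in> topspace (B1 X)"
    by (auto simp: D_def)
  then obtain g where g: "\<And>k. continuous_map X euclideanreal (g k)"
    "\<And>x. x \<in> topspace X \<Longrightarrow> (\<lambda>k. g k x) \<longlonglongrightarrow> f x"
    by (auto simp: topspace_B1 baire_one_def)
  define I where "I = {n. \<forall>x\<in>F n. f x > real n}"
  have "infinite I"
    using f by (auto simp: infinite_nat_iff_unbounded_le D_def I_def)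
  have "\<exists>k. \<forall>x\<in>F n. g k x > real n" if "n \<in> I" for n
  proof -
    have "\<forall>x\<in>F n. \<forall>\<^sub>F k in sequentially. g k x > real n"
      using g(2) F' that by (auto simp: I_def subset_iff intro!: order_tendstoD(1))
    then have "\<forall>\<^sub>F k in sequentially. \<forall>x\<in>F n. g k x > real n"
      using F' by (simp add: eventually_ball_finite)
    then show ?thesis
      by (rule eventually_happens'[OF sequentially_bot])
  qed
  then obtain j where j: "\<And>n x. n \<in> I \<Longrightarrow> x \<in> F n \<Longrightarrow> g (j n) x > real n"
    by metis
  show "\<exists>r V. strict_mono r \<and> (\<forall>k. openin X (V k) \<and> F (r k) \<subseteq> V k) \<and>
      (\<forall>x\<in>topspace X. finite {k :: nat. x \<in> V k})"
  proof (rule subsequence_of_infinite[OF \<open>infinite I\<close>, where V = "\<lambda>n. {x \<in> topspace X. g (j n) x > real n}"])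
    show "openin X {x \<in> topspace X. g (j n) x > real n} \<and> F n \<subseteq> {x \<in> topspace X. g (j n) x > real n}"
      if "n \<in> I" for n
      using continuous_map_less_open[OF g(1)] j that F' by auto
    show "finite {n \<in> I. x \<in> {x \<in> topspace X. g (j n) x > real n}}" if "x \<in> topspace X" for x
    proof -
      \<comment> \<open>Nothing is known about the growth of \<open>j\<close>, so a bound uniform in
        \<open>k\<close> is used: a convergent real sequence is bounded.\<close>
      have "Bseq (\<lambda>k. g k x)"
        using g(2)[OF that] convergent_def convergent_imp_Bseq by blast
      then obtain B where B: "\<And>k. \<bar>g k x\<bar> \<le> B"
        using BseqE by (metis real_norm_def)
      have "n \<le> nat \<lceil>B\<rceil>" if "g (j n) x > real n" for n
        using B[of "j n"] that by linarith
      then have "{n \<in> I. x \<in> {x \<in> topspace X. g (j n) x > real n}} \<subseteq> {..nat \<lceil>B\<rceil>}"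
        by auto
      then show ?thesis
        using finite_subset by blast
    qed
  qed
qed

section \<open>From property (kappa) to sequences in \<open>Cp X\<close>\<close>

text \<open>Each \<open>f n\<close> in \<open>U\<close> is close to \<open>y\<close> on
  \<open>K n\<close>, and its membership in \<open>U\<close> is decided on \<open>K (Suc n)\<close>.
  Thus \<open>f n - y\<close> has to be reproduced where it may be large only on \<open>F n\<close>;
  elsewhere it can be truncated, and a point-finite expansion makes the truncated differences tend
  to 0.\<close>

lemma kappa_property_imp_kappa_Frechet_Urysohn:
  assumes "completely_regular_space X" "Hausdorff_space X" "kappa_property X"
  shows "kappa_Frechet_Urysohn (Cp X)"
  unfolding kappa_Frechet_Urysohn_def
proof (intro allI impI, elim conjE)
  fix U y assume U: "openin (Cp X) U" and y: "y \<in> Cp X closure_of U"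
  have y': "y \<in> topspace (Cp X)"
    using y by (simp add: in_closure_of)
  have step: "\<exists>f K' \<delta>. f \<in> U \<and> finite K' \<and> K' \<subseteq> topspace X \<and> K \<subseteq> K' \<and> \<delta> > 0 \<and>
      (\<forall>x\<in>K. \<bar>f x - y x\<bar> < \<epsilon>) \<and> (\<forall>g\<in>topspace (Cp X). (\<forall>x\<in>K'. \<bar>g x - f x\<bar> < \<delta>) \<longrightarrow> g \<in> U)"
    if K: "finite K" "K \<subseteq> topspace X" "\<epsilon> > 0" for K \<epsilon>
  proof -
    let ?T = "{g \<in> topspace (Cp X). \<forall>x\<in>K. g x \<in> ball (y x) \<epsilon>}"
    have "openin (Cp X) ?T"
      using K by (intro openin_Cp_cylinder) auto
    moreover have "y \<in> ?T"
      using y' K(3) by simp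
    ultimately obtain f where f: "f \<in> U" "f \<in> ?T"
      using y unfolding in_closure_of by meson
    have near: "\<forall>x\<in>K. \<bar>f x - y x\<bar> < \<epsilon>"
      using f(2) by (simp add: dist_real_def abs_minus_commute)
    from f(1) obtain L \<delta> where L: "finite L" "L \<subseteq> topspace X" "\<delta> > 0"
      "\<And>g. g \<in> topspace (Cp X) \<Longrightarrow> (\<forall>x\<in>L. \<bar>g x - f x\<bar> < \<delta>) \<Longrightarrow> g \<in> U"
      using U unfolding openin_Cp by meson
    show ?thesis
      using f(1) near L K by (intro exI[of _ f] exI[of _ "K \<union> L"] exI[of _ \<delta>]) auto
  qed
  \<comment> \<open>The tolerance is dropped: the functions constructed later copy
    \<open>f n\<close> exactly on \<open>K (Suc n)\<close>.\<close>
  have "\<exists>K. \<forall>n. (finite (K n) \<and> K n \<subseteq> topspace X) \<and> (K n \<subseteq> K (Suc n) \<and>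
     (\<exists>f\<in>U. (\<forall>x\<in>K n. \<bar>f x - y x\<bar> < inverse (real (Suc n))) \<and>
       (\<forall>g\<in>topspace (Cp X). (\<forall>x\<in>K (Suc n). g x = f x) \<longrightarrow> g \<in> U)))"
  proof (rule dependent_nat_choice)
    show "\<exists>K. finite K \<and> K \<subseteq> topspace X"
      by blast
    fix K n assume K: "finite K \<and> K \<subseteq> topspace X"
    obtain f K' \<delta> where "f \<in> U" "finite K'" "K' \<subseteq> topspace X" "K \<subseteq> K'" "\<delta> > 0"
      "\<forall>x\<in>K. \<bar>f x - y x\<bar> < inverse (real (Suc n))"
      "\<forall>g\<in>topspace (Cp X). (\<forall>x\<in>K'. \<bar>g x - f x\<bar> < \<delta>) \<longrightarrow> g \<in> U"
      using step[of K "inverse (real (Suc n))"] K by auto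
    then show "\<exists>K'. (finite K' \<and> K' \<subseteq> topspace X) \<and> (K \<subseteq> K' \<and>
     (\<exists>f\<in>U. (\<forall>x\<in>K. \<bar>f x - y x\<bar> < inverse (real (Suc n))) \<and>
       (\<forall>g\<in>topspace (Cp X). (\<forall>x\<in>K'. g x = f x) \<longrightarrow> g \<in> U)))"
      by (intro exI[of _ K'] conjI bexI[of _ f]) auto
  qed
  then obtain K where K: "\<And>n. finite (K n)" "\<And>n. K n \<subseteq> topspace X" "\<And>n. K n \<subseteq> K (Suc n)"
    "\<And>n. \<exists>f\<in>U. (\<forall>x\<in>K n. \<bar>f x - y x\<bar> < inverse (real (Suc n))) \<and>
       (\<forall>g\<in>topspace (Cp X). (\<forall>x\<in>K (Suc n). g x = f x) \<longrightarrow> g \<in> U)"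
    by metis
  obtain f where f: "\<And>n. f n \<in> U" "\<And>n x. x \<in> K n \<Longrightarrow> \<bar>f n x - y x\<bar> < inverse (real (Suc n))"
    "\<And>n g. g \<in> topspace (Cp X) \<Longrightarrow> (\<And>x. x \<in> K (Suc n) \<Longrightarrow> g x = f n x) \<Longrightarrow> g \<in> U"
    using K(4) by metis
  define F where "F n = K (Suc n) - K n" for n
  have "disjoint_family F"
    unfolding F_def using K(3) by (rule disjoint_family_Suc)
  moreover have "finite (F n)" "F n \<subseteq> topspace X" for n
    using K(1,2) by (auto simp: F_def)
  ultimately obtain r V where rV: "strict_mono r" "\<And>k. openin X (V k)" "\<And>k. F (r k) \<subseteq> V k"
    "\<And>x. x \<in> topspace X \<Longrightarrow> finite {k :: nat. x \<in> V k}"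
    using kappa_propertyD[OF assms(3)] by blast
  have cont: "continuous_map X euclideanreal y" "\<And>n. continuous_map X euclideanreal (f n)"
    using y' f(1) U by (auto simp: topspace_Cp openin_Cp)
  have "\<exists>g. continuous_map X euclideanreal g \<and> (\<forall>x\<in>K (Suc (r k)). g x = f (r k) x - y x) \<and>
      (\<forall>x\<in>topspace X - V k. \<bar>g x\<bar> \<le> inverse (real (Suc (r k))))" for k
  proof -
    have "finite (F (r k))"
      using K(1) by (simp add: F_def)
    moreover have "continuous_map X euclideanreal (\<lambda>x. f (r k) x - y x)"
      by (intro continuous_intros cont)
    moreover have "inverse (real (Suc (r k))) \<ge> 0"
      by simp
    ultimately obtain g where g: "continuous_map X euclideanreal g" "\<And>x. x \<in> F (r k) \<Longrightarrow> g x = f (r k) x - y x"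
      "\<And>x. \<bar>f (r k) x - y x\<bar> \<le> inverse (real (Suc (r k))) \<Longrightarrow> g x = f (r k) x - y x"
      "\<And>x. x \<in> topspace X - V k \<Longrightarrow> \<bar>g x\<bar> \<le> inverse (real (Suc (r k)))"
      by (rule truncate_outside[OF assms(1) _ rV(3,2), of k "\<lambda>x. f (r k) x - y x" "inverse (real (Suc (r k)))"]) blast
    \<comment> \<open>On \<open>K (r k)\<close> the difference is below the truncation level and is
      left unchanged; the remaining points form \<open>F (r k)\<close>, where it is kept in
      full.\<close>
    have "g x = f (r k) x - y x" if "x \<in> K (Suc (r k))" for x
      using g(2)[of x] g(3)[OF less_imp_le[OF f(2)]] that unfolding F_def by blast
    then show ?thesis
      using g(1,4) by blast
  qed
  then obtain g where g: "\<And>k. continuous_map X euclideanreal (g k)"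
    "\<And>k x. x \<in> K (Suc (r k)) \<Longrightarrow> g k x = f (r k) x - y x"
    "\<And>k x. x \<in> topspace X - V k \<Longrightarrow> \<bar>g k x\<bar> \<le> inverse (real (Suc (r k)))"
    by metis
  define s where "s k = restrict (\<lambda>x. y x + g k x) (topspace X)" for k
  have s: "s k \<in> topspace (Cp X)" for k
    unfolding s_def by (intro restrict_in_Cp continuous_intros cont g)
  have "s k \<in> U" for k
    using g(2) K(2) by (intro f(3)[OF s, of "r k"]) (auto simp: s_def)
  moreover have "limitin (Cp X) s y sequentially"
  proof (subst limitin_Cp)
    show "\<forall>x\<in>topspace X. (\<lambda>n. s n x) \<longlonglongrightarrow> y x"
    proof
      fix x assume x: "x \<in> topspace X"
      have "(\<lambda>k. g k x) \<longlonglongrightarrow> 0"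
      proof (rule Lim_null_comparison)
        \<comment> \<open>From \<open>M\<close> on, \<open>x\<close> is outside \<open>V k\<close>,
          so the truncation bound applies; \<open>k \<le> r k\<close> then replaces it by a null
          sequence in \<open>k\<close>.\<close>
        obtain M where "\<And>k. x \<in> V k \<Longrightarrow> k < M"
          using rV(4)[OF x] by (auto simp: finite_nat_set_iff_bounded)
        then have "norm (g k x) \<le> inverse (real (Suc k))" if "k \<ge> M" for k
        proof -
          have "\<bar>g k x\<bar> \<le> inverse (real (Suc (r k)))"
            using \<open>\<And>k. x \<in> V k \<Longrightarrow> k < M\<close>[of k] that x by (intro g(3)) auto
          also have "\<dots> \<le> inverse (real (Suc k))"
            using seq_suble[OF rV(1), of k] by (intro le_imp_inverse_le) auto
          finally show ?thesis
            by simp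
        qed
        then show "\<forall>\<^sub>F k in sequentially. norm (g k x) \<le> inverse (real (Suc k))"
          by (auto simp: eventually_sequentially)
      qed (rule LIMSEQ_inverse_real_of_nat)
      then have "(\<lambda>k. y x + g k x) \<longlonglongrightarrow> y x + 0"
        by (intro tendsto_intros)
      then show "(\<lambda>n. s n x) \<longlonglongrightarrow> y x"
        using x by (simp add: s_def)
    qed
  qed (use s y' in auto)
  ultimately show "\<exists>s. range s \<subseteq> U \<and> limitin (Cp X) s y sequentially"
    by blast
qed

section \<open>From property (kappa) to the Baire property of \<open>B1 X\<close>\<close>

text \<open>Makes the given dense open sets decreasing, so that it suffices to enter them along a
  subsequence.\<close>

lemma dense_open_INT_atMost:
  fixes D :: "nat \<Rightarrow> 'b set"
  assumes "\<And>n. openin Y (D n)" "\<And>n. Y closure_of (D n) = topspace Y"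
  shows "openin Y (\<Inter>i\<le>n. D i) \<and> Y closure_of (\<Inter>i\<le>n. D i) = topspace Y"
proof (induction n)
  case 0
  then show ?case
    using assms by simp
next
  case (Suc n)
  have eq: "(\<Inter>i\<le>Suc n. D i) = D (Suc n) \<inter> (\<Inter>i\<le>n. D i)"
    by (simp add: atMost_Suc)
  have "Y closure_of (D (Suc n) \<inter> (\<Inter>i\<le>n. D i)) = Y closure_of (D (Suc n) \<inter> Y closure_of (\<Inter>i\<le>n. D i))"
    by (rule closure_of_openin_Int_closure_of[OF assms(1), symmetric])
  also have "\<dots> = topspace Y"
    using Suc assms openin_subset[OF assms(1)] by (simp add: Int_absorb2)
  finally show ?case
    unfolding eq using Suc assms(1) by blast
qed

text \<open>Interpolating \<open>p\<close> on \<open>K\<close> shows that the cylinder around it is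
  nonempty, so \<open>D\<close> meets it in some \<open>q\<close>; openness of \<open>D\<close> at
  \<open>q\<close> gives \<open>L\<close> and \<open>\<eta>\<close>.\<close>

lemma dense_open_refine:
  assumes "completely_regular_space X" "Hausdorff_space X"
    and "openin (B1 X) D" "B1 X closure_of D = topspace (B1 X)"
    and "finite K" "K \<subseteq> topspace X" "\<epsilon> > 0"
  obtains L q \<eta> where "finite L" "L \<subseteq> topspace X" "\<eta> > 0" "\<And>x. x \<in> K \<Longrightarrow> \<bar>q x - p x\<bar> < \<epsilon>"
    "\<And>g. g \<in> topspace (B1 X) \<Longrightarrow> (\<And>x. x \<in> L \<Longrightarrow> \<bar>g x - q x\<bar> < \<eta>) \<Longrightarrow> g \<in> D"
proof -
  obtain h where h: "continuous_map X euclideanreal h" "\<And>x. x \<in> K \<Longrightarrow> h x = p x"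
    using finite_interpolation[OF assms(1,2,5,6)] by metis
  let ?T = "{f \<in> topspace (B1 X). \<forall>x\<in>K. f x \<in> ball (p x) \<epsilon>}"
  have "restrict h (topspace X) \<in> ?T"
    using h assms(6,7) by (auto intro!: restrict_in_B1 continuous_imp_baire_one)
  moreover have "restrict h (topspace X) \<in> B1 X closure_of D"
    using h(1) assms(4) by (simp add: restrict_in_B1 continuous_imp_baire_one)
  moreover have "openin (B1 X) ?T"
    using assms(5,6) by (intro openin_B1_cylinder) auto
  ultimately obtain q where q: "q \<in> D" "q \<in> ?T"
    unfolding in_closure_of by meson
  from q(1) obtain L \<eta> where L: "finite L" "L \<subseteq> topspace X" "\<eta> > 0"
    "\<And>g. g \<in> topspace (B1 X) \<Longrightarrow> (\<forall>x\<in>L. \<bar>g x - q x\<bar> < \<eta>) \<Longrightarrow> g \<in> D"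
    using assms(3) unfolding openin_B1 by meson
  have near: "\<bar>q x - p x\<bar> < \<epsilon>" if "x \<in> K" for x
    using q(2) that by (simp add: dist_real_def abs_minus_commute)
  show thesis
  proof (rule that[OF L(1-3) near])
    show "g \<in> D" if "g \<in> topspace (B1 X)" "\<And>x. x \<in> L \<Longrightarrow> \<bar>g x - q x\<bar> < \<eta>" for g
      using that by (intro L(4)) auto
  qed
qed

text \<open>A finite \<open>\<epsilon>/2\<close>-net of the bounded functions on \<open>K\<close> makes \<open>K'\<close> independent of \<open>s\<close>.\<close>

lemma dense_open_refine_uniform:
  assumes "completely_regular_space X" "Hausdorff_space X"
    and "openin (B1 X) D" "B1 X closure_of D = topspace (B1 X)"
    and "finite K" "K \<subseteq> topspace X" "\<epsilon> > 0"
  obtains K' where "finite K'" "K' \<subseteq> topspace X" "K \<subseteq> K'"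
    "\<And>s :: 'a \<Rightarrow> real. (\<And>x. x \<in> K \<Longrightarrow> \<bar>s x\<bar> \<le> M) \<Longrightarrow> \<exists>q \<eta>. \<eta> > 0 \<and> (\<forall>x\<in>K. \<bar>q x - s x\<bar> < \<epsilon>) \<and>
       (\<forall>g\<in>topspace (B1 X). (\<forall>x\<in>K'. \<bar>g x - q x\<bar> < \<eta>) \<longrightarrow> g \<in> D)"
proof -
  define N where "N = \<lceil>M / (\<epsilon>/2)\<rceil> + 1"
  define P where "P = PiE K (\<lambda>_. (\<lambda>i. of_int i * (\<epsilon>/2)) ` {-N..N})"
  have "finite P"
    using assms(5) by (simp add: P_def finite_PiE)
  have "\<forall>p. \<exists>L q \<eta>. finite L \<and> L \<subseteq> topspace X \<and> \<eta> > 0 \<and> (\<forall>x\<in>K. \<bar>q x - p x\<bar> < \<epsilon>/2) \<and>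
    (\<forall>g\<in>topspace (B1 X). (\<forall>x\<in>L. \<bar>g x - q x\<bar> < \<eta>) \<longrightarrow> g \<in> D)"
  proof
    fix p
    obtain L q \<eta> where "finite L" "L \<subseteq> topspace X" "\<eta> > 0" "\<And>x. x \<in> K \<Longrightarrow> \<bar>q x - p x\<bar> < \<epsilon>/2"
      "\<And>g. g \<in> topspace (B1 X) \<Longrightarrow> (\<And>x. x \<in> L \<Longrightarrow> \<bar>g x - q x\<bar> < \<eta>) \<Longrightarrow> g \<in> D"
      by (rule dense_open_refine[OF assms(1-6) half_gt_zero[OF assms(7)], where p = p]) blast
    then show "\<exists>L q \<eta>. finite L \<and> L \<subseteq> topspace X \<and> \<eta> > 0 \<and> (\<forall>x\<in>K. \<bar>q x - p x\<bar> < \<epsilon>/2) \<and>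
      (\<forall>g\<in>topspace (B1 X). (\<forall>x\<in>L. \<bar>g x - q x\<bar> < \<eta>) \<longrightarrow> g \<in> D)"
      by (intro exI[of _ L] exI[of _ q] exI[of _ \<eta>]) auto
  qed
  then obtain L q \<eta> where L: "\<And>p. finite (L p)" "\<And>p. L p \<subseteq> topspace X" "\<And>p. \<eta> p > 0"
    "\<And>p x. x \<in> K \<Longrightarrow> \<bar>q p x - p x\<bar> < \<epsilon>/2"
    "\<And>p g. g \<in> topspace (B1 X) \<Longrightarrow> (\<forall>x\<in>L p. \<bar>g x - q p x\<bar> < \<eta> p) \<Longrightarrow> g \<in> D"
    by metis
  show thesis
  proof
    show "finite (K \<union> (\<Union>p\<in>P. L p))" "K \<union> (\<Union>p\<in>P. L p) \<subseteq> topspace X"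
      using assms(5,6) \<open>finite P\<close> L(1,2) by auto
    fix s :: "'a \<Rightarrow> real" assume s: "\<And>x. x \<in> K \<Longrightarrow> \<bar>s x\<bar> \<le> M"
    \<comment> \<open>\<open>s\<close> is rounded down to the net. The tolerance may depend on the
      resulting \<open>p\<close>; only the finite set is common to all of \<open>P\<close>.\<close>
    define p where "p = restrict (\<lambda>x. of_int \<lfloor>s x / (\<epsilon>/2)\<rfloor> * (\<epsilon>/2)) K"
    have "\<lfloor>s x / (\<epsilon>/2)\<rfloor> \<in> {-N..N}" if "x \<in> K" for x
    proof -
      have "\<bar>s x / (\<epsilon>/2)\<bar> \<le> M / (\<epsilon>/2)"
        using s[OF that] assms(7) by (simp add: abs_divide divide_right_mono)
      then show ?thesis
        unfolding N_def atLeastAtMost_iff by linarith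
    qed
    then have "p \<in> P"
      by (auto simp: p_def P_def)
    have near: "\<bar>p x - s x\<bar> \<le> \<epsilon>/2" if "x \<in> K" for x
    proof -
      define t where "t = s x / (\<epsilon>/2)"
      have "s x = t * (\<epsilon>/2)"
        using assms(7) by (simp add: t_def)
      then have "p x - s x = (of_int \<lfloor>t\<rfloor> - t) * (\<epsilon>/2)"
        using that by (simp add: p_def t_def[symmetric] algebra_simps)
      then have "\<bar>p x - s x\<bar> = \<bar>of_int \<lfloor>t\<rfloor> - t\<bar> * (\<epsilon>/2)"
        using assms(7) by (simp only: abs_mult)
      also have "\<dots> \<le> 1 * (\<epsilon>/2)"
        using assms(7) by (intro mult_right_mono) linarith+
      finally show ?thesis
        by simp
    qed
    have "\<bar>q p x - s x\<bar> < \<epsilon>" if "x \<in> K" for x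
      using L(4)[OF that, of p] near[OF that] by linarith
    moreover have "g \<in> D" if "g \<in> topspace (B1 X)" "\<forall>x\<in>K \<union> (\<Union>p\<in>P. L p). \<bar>g x - q p x\<bar> < \<eta> p" for g
      by (rule L(5)[of g p]) (use that \<open>p \<in> P\<close> in auto)
    ultimately show "\<exists>q \<eta>. \<eta> > 0 \<and> (\<forall>x\<in>K. \<bar>q x - s x\<bar> < \<epsilon>) \<and>
       (\<forall>g\<in>topspace (B1 X). (\<forall>x\<in>K \<union> (\<Union>p\<in>P. L p). \<bar>g x - q x\<bar> < \<eta>) \<longrightarrow> g \<in> D)"
      using L(3) by blast
  qed auto
qed

text \<open>The increments are controlled only from \<open>j\<close> on, because at a given point
  finitely many stages may change the function by a large amount. The final bound is half the
  tolerance, which leaves room for strict inequality.\<close>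

lemma convergent_of_halving_bounds:
  fixes a \<delta> :: "nat \<Rightarrow> real"
  assumes "\<And>i. \<delta> i > 0" "\<And>i. \<delta> (Suc i) \<le> \<delta> i / 2"
    and "\<And>i. i \<ge> j \<Longrightarrow> \<bar>a (Suc i) - a i\<bar> \<le> \<delta> i / 4"
  shows "convergent a" "\<bar>lim a - a j\<bar> \<le> \<delta> j / 2"
proof -
  have bd: "\<bar>a m - a n\<bar> \<le> \<delta> n / 2" if "j \<le> n" "n \<le> m" for m n
  proof -
    \<comment> \<open>The subtracted term lets the sum telescope: halving gives
      \<open>\<delta> m / 4 \<le> \<delta> m / 2 - \<delta> (Suc m) / 2\<close>.\<close>
    have "\<bar>a m - a n\<bar> \<le> \<delta> n / 2 - \<delta> m / 2"
      using that(2)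
    proof (induction m rule: dec_induct)
      case (step m)
      then show ?case
        using assms(2)[of m] assms(3)[of m] that(1) by linarith
    qed simp
    then show ?thesis
      using assms(1)[of m] by linarith
  qed
  have geo: "\<delta> n \<le> \<delta> 0 * (1/2) ^ n" for n
  proof (induction n)
    case (Suc n)
    then show ?case
      using assms(2)[of n] by simp
  qed simp
  have "(\<lambda>n. \<delta> 0 * (1/2) ^ n) \<longlonglongrightarrow> \<delta> 0 * 0"
    by (intro tendsto_intros) auto
  then have "(\<lambda>n. \<delta> 0 * (1/2) ^ n) \<longlonglongrightarrow> 0"
    by simp
  then have \<delta>0: "\<delta> \<longlonglongrightarrow> 0"
  proof (rule Lim_null_comparison[rotated])
    show "\<forall>\<^sub>F n in sequentially. norm (\<delta> n) \<le> \<delta> 0 * (1/2) ^ n"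
      using geo abs_of_pos[OF assms(1)] by simp
  qed
  have "Cauchy a"
  proof (rule CauchyI')
    fix e :: real assume "e > 0"
    then obtain n where n: "\<And>m. m \<ge> n \<Longrightarrow> \<delta> m < e"
      using order_tendstoD(2)[OF \<delta>0] by (auto simp: eventually_sequentially)
    have "dist (a k) (a m) < e" if "max j n \<le> k" "k < m" for k m
    proof -
      have "\<bar>a m - a k\<bar> \<le> \<delta> k / 2" "\<delta> k < e"
        using bd[of k m] n[of k] that by auto
      then show ?thesis
        unfolding dist_real_def using assms(1)[of k] by linarith
    qed
    then show "\<exists>M. \<forall>m\<ge>M. \<forall>n>m. dist (a m) (a n) < e"
      by (intro exI[of _ "max j n"]) simp
  qed
  then show "convergent a"
    by (simp add: Cauchy_convergent_iff)
  then have "a \<longlonglongrightarrow> lim a"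
    by (simp add: convergent_LIMSEQ_iff)
  then have "(\<lambda>m. \<bar>a m - a j\<bar>) \<longlonglongrightarrow> \<bar>lim a - a j\<bar>"
    by (intro tendsto_intros)
  then show "\<bar>lim a - a j\<bar> \<le> \<delta> j / 2"
    by (rule LIMSEQ_le_const2) (intro exI[of _ j] allI impI bd order_refl)
qed

text \<open>Continuous functions are corrected stage by stage. A stage enters some
  \<open>D n\<close> robustly on a finite set, and every later correction is small on that set, so
  the limit remains in \<open>D n\<close>. Point-finiteness gives pointwise convergence, hence a
  Baire-one limit.\<close>

lemma kappa_property_imp_Baire_B1:
  assumes X: "completely_regular_space X" "Hausdorff_space X" and \<kappa>: "kappa_property X"
  shows "Baire_space (B1 X)"
  unfolding Baire_space_def
proof (intro allI impI)
  fix D0 :: "nat \<Rightarrow> ('a \<Rightarrow> real) set"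
  assume D0: "\<forall>n. openin (B1 X) (D0 n) \<and> B1 X closure_of (D0 n) = topspace (B1 X)"
  define D where "D n = (\<Inter>i\<le>n. D0 i)" for n
  have D: "openin (B1 X) (D n)" "B1 X closure_of (D n) = topspace (B1 X)" for n
    using dense_open_INT_atMost[of "B1 X" D0 n] D0 by (auto simp: D_def)
  have "w \<in> B1 X closure_of (\<Inter>n. D0 n)" if w: "w \<in> topspace (B1 X)" for w
    unfolding in_closure_of
  proof (intro conjI allI impI w, elim conjE)
    fix T assume "w \<in> T" "openin (B1 X) T"
    then obtain K0 \<delta>0 where K0: "finite K0" "K0 \<subseteq> topspace X" "\<delta>0 > 0"
      "\<And>g. g \<in> topspace (B1 X) \<Longrightarrow> (\<forall>x\<in>K0. \<bar>g x - w x\<bar> < \<delta>0) \<Longrightarrow> g \<in> T"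
      unfolding openin_B1 by meson
    \<comment> \<open>Quantifying over all \<open>s\<close> bounded by \<open>n\<close> allows the
      sets \<open>K n\<close>, and with them \<open>r\<close> and \<open>V\<close>, to be fixed
      before any approximation is chosen.\<close>
    define good where "good n K K' \<longleftrightarrow> (\<forall>s. (\<forall>x\<in>K. \<bar>s x\<bar> \<le> real n) \<longrightarrow>
        (\<exists>q \<eta>. \<eta> > 0 \<and> (\<forall>x\<in>K. \<bar>q x - s x\<bar> < inverse (real (Suc n))) \<and>
          (\<forall>g\<in>topspace (B1 X). (\<forall>x\<in>K'. \<bar>g x - q x\<bar> < \<eta>) \<longrightarrow> g \<in> D n)))" for n K K'
    have "\<exists>K. \<forall>n. (finite (K n) \<and> K n \<subseteq> topspace X \<and> K0 \<subseteq> K n) \<and>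
        (K n \<subseteq> K (Suc n) \<and> good n (K n) (K (Suc n)))"
    proof (rule dependent_nat_choice)
      show "\<exists>K. finite K \<and> K \<subseteq> topspace X \<and> K0 \<subseteq> K"
        using K0 by blast
      fix K n assume K: "finite K \<and> K \<subseteq> topspace X \<and> K0 \<subseteq> K"
      obtain K' where "finite K'" "K' \<subseteq> topspace X" "K \<subseteq> K'"
        "\<And>s. (\<And>x. x \<in> K \<Longrightarrow> \<bar>s x\<bar> \<le> real n) \<Longrightarrow> \<exists>q \<eta>. \<eta> > 0 \<and> (\<forall>x\<in>K. \<bar>q x - s x\<bar> < inverse (real (Suc n))) \<and>
          (\<forall>g\<in>topspace (B1 X). (\<forall>x\<in>K'. \<bar>g x - q x\<bar> < \<eta>) \<longrightarrow> g \<in> D n)"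
        by (rule dense_open_refine_uniform[OF X D[of n], of K "inverse (real (Suc n))" "real n"]) (use K in auto)
      then show "\<exists>K'. (finite K' \<and> K' \<subseteq> topspace X \<and> K0 \<subseteq> K') \<and> (K \<subseteq> K' \<and> good n K K')"
        using K unfolding good_def by (intro exI[of _ K']) auto
    qed
    then obtain K where K: "\<And>n. finite (K n)" "\<And>n. K n \<subseteq> topspace X" "\<And>n. K0 \<subseteq> K n"
      "\<And>n. K n \<subseteq> K (Suc n)" "\<And>n. good n (K n) (K (Suc n))"
      by metis
    have K_mono: "K m \<subseteq> K n" if "m \<le> n" for m n
      using K(4) that by (rule lift_Suc_mono_le)
    define F where "F n = K (Suc n) - K n" for n
    have "disjoint_family F"
      unfolding F_def using K(4) by (rule disjoint_family_Suc)
    moreover have F: "finite (F n)" "F n \<subseteq> topspace X" for n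
      using K(1,2) by (auto simp: F_def)
    ultimately obtain r V0 where r: "strict_mono r" and V0: "\<And>k. openin X (V0 k)" "\<And>k. F (r k) \<subseteq> V0 k"
      "\<And>x. x \<in> topspace X \<Longrightarrow> finite {k :: nat. x \<in> V0 k}"
      using kappa_propertyD[OF \<kappa>] by blast
    \<comment> \<open>Removing the finite closed set \<open>K (r k)\<close> retains
      \<open>F (r k)\<close>, which is disjoint from it, and makes each correction small on all
      earlier finite sets.\<close>
    define V where "V k = V0 k - K (r k)" for k
    have V: "openin X (V k)" "F (r k) \<subseteq> V k" for k
      using V0(1,2)[of k] closedin_Hausdorff_finite[OF X(2) K(2,1)] by (auto simp: V_def F_def)
    \<comment> \<open>A state holds the current function, the last index used in the subsequence and
      the tolerance for later changes. Boundedness is recorded so that some later \<open>n\<close>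
      dominates the function.\<close>
    define P where "P = (\<lambda>(s, k :: nat, \<delta>). continuous_map X euclideanreal s \<and>
      (\<exists>B. \<forall>x\<in>topspace X. \<bar>s x\<bar> \<le> B) \<and> \<delta> > (0::real))"
    define Q where "Q = (\<lambda>(s, k :: nat, \<delta>) (s', k' :: nat, \<delta>'). k < k' \<and> \<delta>' \<le> \<delta> / 2 \<and>
      (\<forall>x\<in>topspace X - V k'. \<bar>s' x - s x\<bar> \<le> \<delta> / 4) \<and>
      (\<forall>g\<in>topspace (B1 X). (\<forall>x\<in>K (Suc (r k')). \<bar>g x - s' x\<bar> < \<delta>') \<longrightarrow> g \<in> D (r k')))"
    have step: "\<exists>\<sigma>'. P \<sigma>' \<and> Q \<sigma> \<sigma>'" if P\<sigma>: "P \<sigma>" for \<sigma>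
    proof -
      obtain s k \<delta> where \<sigma>: "\<sigma> = (s, k, \<delta>)"
        by (cases \<sigma>) auto
      obtain B where s: "continuous_map X euclideanreal s" "\<And>x. x \<in> topspace X \<Longrightarrow> \<bar>s x\<bar> \<le> B" "\<delta> > 0"
        using P\<sigma> by (auto simp: P_def \<sigma>)
      \<comment> \<open>Since \<open>k' \<le> r k'\<close>, a large \<open>k'\<close> achieves two
        things at level \<open>r k'\<close>: \<open>good\<close> applies to \<open>s\<close>, and
        the error on \<open>K n\<close> drops below \<open>\<delta> / 4\<close>.\<close>
      obtain m where "max B (4 / \<delta>) \<le> real m"
        using real_arch_simple by blast
      then obtain k' where k': "k < k'" "B \<le> real k'" "4 / \<delta> \<le> real k'"
        by (intro that[of "m + k + 1"]) auto
      define n where "n = r k'"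
      have "k' \<le> n"
        unfolding n_def using r by (rule seq_suble)
      then have n: "B \<le> real n" "inverse (real (Suc n)) \<le> \<delta> / 4"
      proof -
        show "B \<le> real n"
          using k'(2) \<open>k' \<le> n\<close> by linarith
        have "4 / \<delta> \<le> real (Suc n)"
          using k'(3) \<open>k' \<le> n\<close> by linarith
        then have "inverse (real (Suc n)) \<le> inverse (4 / \<delta>)"
          using s(3) by (intro le_imp_inverse_le) auto
        then show "inverse (real (Suc n)) \<le> \<delta> / 4"
          by simp
      qed
      have "\<forall>x\<in>K n. \<bar>s x\<bar> \<le> real n"
        using s(2) K(2) n(1) by (meson order_trans subsetD)
      then obtain q \<eta> where q: "\<eta> > 0" "\<And>x. x \<in> K n \<Longrightarrow> \<bar>q x - s x\<bar> < inverse (real (Suc n))"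
        "\<And>g. g \<in> topspace (B1 X) \<Longrightarrow> (\<forall>x\<in>K (Suc n). \<bar>g x - q x\<bar> < \<eta>) \<Longrightarrow> g \<in> D n"
        using K(5)[unfolded good_def, THEN spec, THEN mp, of n s] by blast
      obtain h C where h: "continuous_map X euclideanreal h" "\<And>x. x \<in> K (Suc n) \<Longrightarrow> h x = q x - s x"
        "\<And>x. x \<in> topspace X \<Longrightarrow> \<bar>h x\<bar> \<le> C"
        by (rule finite_interpolation[OF X K(1,2), of "Suc n" "\<lambda>x. q x - s x"]) blast
      have "\<delta> / 4 \<ge> 0" "F n \<subseteq> V k'"
        using s(3) V(2)[of k'] by (auto simp: n_def)
      from this(2,1) obtain g where g: "continuous_map X euclideanreal g" "\<And>x. x \<in> F n \<Longrightarrow> g x = h x"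
        "\<And>x. \<bar>h x\<bar> \<le> \<delta> / 4 \<Longrightarrow> g x = h x" "\<And>x. x \<in> topspace X - V k' \<Longrightarrow> \<bar>g x\<bar> \<le> \<delta> / 4"
        "\<And>x. x \<in> topspace X \<Longrightarrow> \<bar>g x\<bar> \<le> \<bar>h x\<bar>"
        by (rule truncate_outside[OF X(1) F(1) _ V(1) h(1), of n k' "\<delta> / 4"]) blast
      \<comment> \<open>On \<open>K n\<close> the correction is too small to be truncated, and on
        \<open>F n\<close> it is kept in full, so the new function equals \<open>q\<close> on all of
        \<open>K (Suc n)\<close>.\<close>
      have gh: "s x + g x = q x" if "x \<in> K (Suc n)" for x
      proof (cases "x \<in> K n")
        case True
        then have "\<bar>h x\<bar> \<le> \<delta> / 4"
          using q(2)[OF True] h(2)[OF that] n(2) by simp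
        then show ?thesis
          using g(3) h(2)[OF that] by simp
      next
        case False
        then show ?thesis
          using g(2)[of x] h(2)[OF that] that by (simp add: F_def)
      qed
      have "\<bar>s x + g x\<bar> \<le> B + C" if "x \<in> topspace X" for x
        using s(2)[OF that] g(5)[OF that] h(3)[OF that] by linarith
      \<comment> \<open>\<open>\<eta>\<close> secures membership in \<open>D n\<close>, and
        \<open>\<delta> / 2\<close> the halving of tolerances.\<close>
      then have "P (\<lambda>x. s x + g x, k', min \<eta> (\<delta> / 2))"
        using s g(1) q(1) by (auto simp: P_def intro!: continuous_intros)
      moreover have "Q \<sigma> (\<lambda>x. s x + g x, k', min \<eta> (\<delta> / 2))"
        using k'(1) g(4) q(3) gh by (simp add: Q_def \<sigma> n_def)
      ultimately show ?thesis
        by blast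
    qed
    obtain s0 B where s0: "continuous_map X euclideanreal s0" "\<And>x. x \<in> K0 \<Longrightarrow> s0 x = w x"
      "\<And>x. x \<in> topspace X \<Longrightarrow> \<bar>s0 x\<bar> \<le> B"
      by (rule finite_interpolation[OF X K0(1,2), of w]) blast
    \<comment> \<open>The clause for \<open>i = 0\<close> fixes the start: \<open>s0\<close> agrees
      with \<open>w\<close> on \<open>K0\<close>, and staying within \<open>\<delta>0\<close> there
      means membership in \<open>T\<close>.\<close>
    have "\<exists>\<Sigma>. \<forall>i. (P (\<Sigma> i) \<and> (i = 0 \<longrightarrow> \<Sigma> i = (s0, 0, \<delta>0))) \<and> Q (\<Sigma> i) (\<Sigma> (Suc i))"
    proof (rule dependent_nat_choice)
      show "\<exists>\<sigma>. P \<sigma> \<and> (0 = 0 \<longrightarrow> \<sigma> = (s0, 0, \<delta>0))"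
        using s0(1,3) K0(3) by (auto simp: P_def)
    qed (use step in auto)
    then obtain \<Sigma> where \<Sigma>: "\<And>i. P (\<Sigma> i)" "\<Sigma> 0 = (s0, 0, \<delta>0)" "\<And>i. Q (\<Sigma> i) (\<Sigma> (Suc i))"
      by metis
    define s where "s i = fst (\<Sigma> i)" for i
    define k where "k i = fst (snd (\<Sigma> i))" for i
    define \<delta> where "\<delta> i = snd (snd (\<Sigma> i))" for i
    have \<Sigma>_eq: "\<Sigma> i = (s i, k i, \<delta> i)" for i
      by (simp add: s_def k_def \<delta>_def)
    have s: "continuous_map X euclideanreal (s i)" "\<delta> i > 0" for i
      using \<Sigma>(1)[of i] by (auto simp: \<Sigma>_eq P_def)
    have Q: "k i < k (Suc i)" "\<delta> (Suc i) \<le> \<delta> i / 2"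
      "x \<in> topspace X \<Longrightarrow> x \<notin> V (k (Suc i)) \<Longrightarrow> \<bar>s (Suc i) x - s i x\<bar> \<le> \<delta> i / 4"
      "g \<in> topspace (B1 X) \<Longrightarrow> (\<forall>x\<in>K (Suc (r (k (Suc i)))). \<bar>g x - s (Suc i) x\<bar> < \<delta> (Suc i)) \<Longrightarrow>
         g \<in> D (r (k (Suc i)))" for i x g
      using \<Sigma>(3)[of i] by (auto simp: \<Sigma>_eq Q_def)
    have init: "s 0 = s0" "\<delta> 0 = \<delta>0"
      using \<Sigma>(2) by (auto simp: \<Sigma>_eq)
    have k: "strict_mono k"
      using Q(1) by (simp add: strict_mono_Suc_iff)
    have conv: "convergent (\<lambda>i. s i x)" if x: "x \<in> topspace X" for x
    proof -
      \<comment> \<open>Injectivity of \<open>k\<close> transfers point-finiteness to the stages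
        actually used.\<close>
      have "finite (k -` {j. x \<in> V0 j})"
        using V0(3)[OF x] k by (intro finite_vimageI) (auto simp: inj_def strict_mono_eq)
      then obtain M where M: "\<And>i. x \<in> V0 (k i) \<Longrightarrow> i < M"
        by (auto simp: finite_nat_set_iff_bounded)
      show ?thesis
      proof (rule convergent_of_halving_bounds(1)[where \<delta> = \<delta> and j = M, OF s(2) Q(2)])
        fix i assume "M \<le> i"
        then have "x \<notin> V (k (Suc i))"
          using M[of "Suc i"] by (auto simp: V_def)
        then show "\<bar>s (Suc i) x - s i x\<bar> \<le> \<delta> i / 4"
          by (rule Q(3)[OF x])
      qed
    qed
    define f where "f = restrict (\<lambda>x. lim (\<lambda>i. s i x)) (topspace X)"
    have "baire_one X (\<lambda>x. lim (\<lambda>i. s i x))"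
      unfolding baire_one_def using s(1) conv by (auto simp: convergent_LIMSEQ_iff)
    then have f: "f \<in> topspace (B1 X)"
      unfolding f_def by (rule restrict_in_B1)
    have close: "\<bar>f x - s j x\<bar> < \<delta> j" if x: "x \<in> topspace X" and "\<And>i. j \<le> i \<Longrightarrow> x \<notin> V (k (Suc i))" for x j
    proof -
      have "\<bar>lim (\<lambda>i. s i x) - s j x\<bar> \<le> \<delta> j / 2"
        using that by (intro convergent_of_halving_bounds(2)[where \<delta> = \<delta> and a = "\<lambda>i. s i x", OF s(2) Q(2)] Q(3)) auto
      then show ?thesis
        using s(2)[of j] x by (simp add: f_def)
    qed
    have "f \<in> T"
    proof (rule K0(4)[OF f], intro ballI)
      fix x assume x: "x \<in> K0"
      then have "\<bar>f x - s 0 x\<bar> < \<delta> 0"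
        using K0(2) K(3) by (intro close) (auto simp: V_def)
      then show "\<bar>f x - w x\<bar> < \<delta>0"
        using s0(2)[OF x] by (simp add: init)
    qed
    moreover have "f \<in> D0 n" for n
    proof -
      \<comment> \<open>\<open>Q\<close> describes the successor state, hence \<open>Suc n\<close>;
        as \<open>n \<le> r (k (Suc n))\<close>, this intersection includes \<open>D0 n\<close>
        among its factors.\<close>
      have "f \<in> D (r (k (Suc n)))"
      proof (rule Q(4)[OF f], intro ballI close)
        fix x assume x: "x \<in> K (Suc (r (k (Suc n))))"
        show "x \<in> topspace X"
          using x K(2) by blast
        fix i assume "Suc n \<le> i"
        \<comment> \<open>The set deciding membership is thus contained in
          \<open>K (r (k (Suc i)))\<close>, which was removed from
          \<open>V (k (Suc i))\<close>.\<close>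
        then have "Suc (r (k (Suc n))) \<le> r (k (Suc i))"
          using r k by (simp add: Suc_le_eq strict_mono_less)
        then show "x \<notin> V (k (Suc i))"
          using K_mono x by (auto simp: V_def)
      qed
      moreover have "n \<le> r (k (Suc n))"
        using seq_suble[OF r, of "k (Suc n)"] seq_suble[OF k, of "Suc n"] by linarith
      ultimately show ?thesis
        by (auto simp: D_def)
    qed
    ultimately show "\<exists>y. y \<in> (\<Inter>n. D0 n) \<and> y \<in> T"
      by blast
  qed
  then show "B1 X closure_of (\<Inter>n. D0 n) = topspace (B1 X)"
    using closure_of_subset_topspace[of "B1 X" "\<Inter>n. D0 n"] by blast
qed

theorem theorem3p1:
  fixes X :: "'a topology"
  assumes "completely_regular_space X" and "Hausdorff_space X"
  shows "kappa_Frechet_Urysohn (Cp X) \<longleftrightarrow> Baire_space (B1 X)"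
  using kappa_Frechet_Urysohn_imp_kappa_property[OF assms] kappa_property_imp_Baire_B1[OF assms]
    Baire_B1_imp_kappa_property[OF assms] kappa_property_imp_kappa_Frechet_Urysohn[OF assms]
  by blast

end
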